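(* Consider a dynamical network of $N$ linear time-invariant systems $G_1,\dots,G_N$ interconnected over a directed graph $\Gamma=(\Omega,E)$ whose associated undirected graph $\hat\Gamma=(\Omega,\hat E)$ is acyclic, with each $G_i$ of the form $$\dot x_i=A_ix_i+\sum_{j\in\mathcal N_i}B_{ij}v_{ij},\qquad w_{ij}=C_{ij}x_i\quad(j\in\mathcal N_i)$$ (i.e. all direct feed-through matrices $D_{ij}$ are zero). Suppose the network admits an additive quadratic Lyapunov function $V(x)=\sum_{i=1}^N x_i^\top P_ix_i$. Then the network is robustly stable with respect to removal (disconnection) of an arbitrary edge from $\hat\Gamma$: for every edge of $\hat\Gamma$, the network obtained by disconnecting this edge is stable.
   Context: Dynamical network. $\Gamma=(\Omega,E)$ is a finite directed graph (no self-loops) whose vertices $\Omega=\{G_1,\dots,G_N\}$ are linear time-invariant systems with states $x_i\in\mathbb{R}^{n_i}$. A directed edge $(G_i,G_j)\in E$ means that an output signal $w_{ij}$ of $G_i$ is an input signal $v_{ji}$ of $G_j$, with interconnection constraint $v_{ji}=w_{ij}$. The undirected graph $\hat\Gamma=(\Omega,\hat E)$ has an edge between $G_i$ and $G_j$ iff $(G_i,G_j)\in E$ or $(G_j,G_i)\in E$, and $\mathcal N_i=\{j:(G_i,G_j)\in\hat E\}$. If $(G_i,G_j)\notin E$, the signals $w_{ij}$ and $v_{ji}$ are absent (zero-dimensional). All matrices are real. With all interconnection constraints imposed, the network has the form $\dot x=\mathcal A x$, $x=\mathrm{col}(x_1,\dots,x_N)$. It admits an additive quadratic Lyapunov function $V(x)=\sum_i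 x_i^\top P_ix_i$ if the $P_i\in\mathbb{R}^{n_i\times n_i}$ are symmetric, $P_i\succ0$, and $\mathcal A^\top P+P\mathcal A\prec0$ with $P=\mathrm{diag}(P_1,\dots,P_N)$. "Stable" means asymptotically stable. Disconnecting the edge between $G_i$ and $G_j$ of $\hat\Gamma$ means replacing the constraints $v_{ji}=w_{ij}$ and $v_{ij}=w_{ji}$ by $v_{ji}=0$ and $v_{ij}=0$, keeping all other interconnections. *)

theory Defs
  imports Complex_Main "Jordan_Normal_Form.Matrix"
begin

section \<open>Networks of linear time-invariant systems\<close>

text \<open>
  The systems are indexed by \<open>0, \<dots>, nsys - 1\<close>.  System \<open>i\<close> has state dimension \<open>sdim i\<close>, and
  \<open>idim i j\<close> is the common dimension of the input \<open>v i j\<close> of system \<open>i\<close> coming from system \<open>j\<close>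
  and of the output \<open>w j i\<close> of system \<open>j\<close> going to system \<open>i\<close>.
\<close>

record network =
  nsys :: nat
  edges :: "(nat \<times> nat) set"
  sdim :: "nat \<Rightarrow> nat"
  idim :: "nat \<Rightarrow> nat \<Rightarrow> nat"
  Amat :: "nat \<Rightarrow> real mat"
  Bmat :: "nat \<Rightarrow> nat \<Rightarrow> real mat"
  Cmat :: "nat \<Rightarrow> nat \<Rightarrow> real mat"

definition uedges :: "network \<Rightarrow> (nat \<times> nat) set" where
  "uedges G = {(i, j). (i, j) \<in> edges G \<or> (j, i) \<in> edges G}"

definition nbrs :: "network \<Rightarrow> nat \<Rightarrow> nat set" where
  "nbrs G i = {j. (i, j) \<in> uedges G}"

text \<open>
  Signals that do not belong to a directed edge are zero-dimensional; the library's matrices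
  may have zero rows or columns, and products through dimension zero are zero matrices.
\<close>

definition dynamical_network :: "network \<Rightarrow> bool" where
  "dynamical_network G \<longleftrightarrow>
     edges G \<subseteq> {..<nsys G} \<times> {..<nsys G} \<and>
     (\<forall>i. (i, i) \<notin> edges G) \<and>
     (\<forall>i j. (j, i) \<notin> edges G \<longrightarrow> idim G i j = 0) \<and>
     (\<forall>i<nsys G. Amat G i \<in> carrier_mat (sdim G i) (sdim G i)) \<and>
     (\<forall>i<nsys G. \<forall>j\<in>nbrs G i.
        Bmat G i j \<in> carrier_mat (sdim G i) (idim G i j) \<and>
        Cmat G i j \<in> carrier_mat (idim G j i) (sdim G i))"

text \<open>
  The undirected graph is simple, so a cycle is a closed walk through at least three pairwise
  distinct vertices.
\<close>

definition undirected_acyclic :: "network \<Rightarrow> bool" where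
  "undirected_acyclic G \<longleftrightarrow>
     \<not> (\<exists>c. length c \<ge> 3 \<and> distinct c \<and>
          (\<forall>k<length c. (c ! k, c ! (Suc k mod length c)) \<in> uedges G))"


section \<open>Solutions and stability\<close>

text \<open>
  \<open>K\<close> is the set of directed edges \<open>(i, j)\<close> whose constraint \<open>v j i = w i j\<close> is imposed; on all
  other edges the constraint is \<open>v j i = 0\<close>.  The original network has \<open>K = edges G\<close>.
\<close>

definition network_solution ::
  "network \<Rightarrow> (nat \<times> nat) set \<Rightarrow> (nat \<Rightarrow> real \<Rightarrow> real vec) \<Rightarrow>
     (nat \<Rightarrow> nat \<Rightarrow> real \<Rightarrow> real vec) \<Rightarrow> (nat \<Rightarrow> nat \<Rightarrow> real \<Rightarrow> real vec) \<Rightarrow> bool" where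
  "network_solution G K x v w \<longleftrightarrow>
     (\<forall>t\<ge>0. \<forall>i<nsys G.
        x i t \<in> carrier_vec (sdim G i) \<and>
        (\<forall>j\<in>nbrs G i. v i j t \<in> carrier_vec (idim G i j) \<and> w i j t \<in> carrier_vec (idim G j i)) \<and>
        (\<forall>k<sdim G i.
           ((\<lambda>s. x i s $ k) has_real_derivative
              (Amat G i *\<^sub>v x i t) $ k + (\<Sum>j\<in>nbrs G i. (Bmat G i j *\<^sub>v v i j t) $ k))
             (at t within {0..})) \<and>
        (\<forall>j\<in>nbrs G i. w i j t = Cmat G i j *\<^sub>v x i t) \<and>
        (\<forall>j\<in>nbrs G i. v i j t = (if (j, i) \<in> K then w j i t else 0\<^sub>v (idim G i j))))"

definition network_state_norm :: "network \<Rightarrow> (nat \<Rightarrow> real \<Rightarrow> real vec) \<Rightarrow> real \<Rightarrow> real" where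
  "network_state_norm G x t = sqrt (\<Sum>i<nsys G. x i t \<bullet> x i t)"

text \<open>
  Asymptotic stability of the origin: Lyapunov stability together with attractivity, which for a
  linear system is global.
\<close>

definition network_stable :: "network \<Rightarrow> (nat \<times> nat) set \<Rightarrow> bool" where
  "network_stable G K \<longleftrightarrow>
     (\<forall>\<epsilon>>0. \<exists>\<delta>>0. \<forall>x v w. network_solution G K x v w \<and> network_state_norm G x 0 < \<delta> \<longrightarrow>
        (\<forall>t\<ge>0. network_state_norm G x t < \<epsilon>)) \<and>
     (\<forall>x v w. network_solution G K x v w \<longrightarrow> (network_state_norm G x \<longlongrightarrow> 0) at_top)"


section \<open>The closed-loop matrix\<close>

definition offset :: "network \<Rightarrow> nat \<Rightarrow> nat" where
  "offset G i = (\<Sum>l<i. sdim G l)"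

abbreviation total_dim :: "network \<Rightarrow> nat" where
  "total_dim G \<equiv> offset G (nsys G)"

definition block_range :: "network \<Rightarrow> nat \<Rightarrow> nat set" where
  "block_range G i = {offset G i ..< offset G i + sdim G i}"

text \<open>
  Since the block ranges are disjoint, at most one summand below is nonzero for any entry.
\<close>

definition block_col :: "network \<Rightarrow> (nat \<Rightarrow> real vec) \<Rightarrow> real vec" where
  "block_col G y = vec (total_dim G) (\<lambda>p. \<Sum>i<nsys G.
     if p \<in> block_range G i then y i $ (p - offset G i) else 0)"

definition block_mat :: "network \<Rightarrow> (nat \<Rightarrow> nat \<Rightarrow> real mat) \<Rightarrow> real mat" where
  "block_mat G M = mat (total_dim G) (total_dim G) (\<lambda>(p, q). \<Sum>i<nsys G. \<Sum>j<nsys G.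
     if p \<in> block_range G i \<and> q \<in> block_range G j
     then M i j $$ (p - offset G i, q - offset G j) else 0)"

text \<open>
  Substituting \<open>v i j = w j i = Cmat G j i *\<^sub>v x j\<close> for \<open>(j, i) \<in> K\<close> and \<open>v i j = 0\<close> otherwise
  into the state equations; see \<open>network_solution_iff\<close> below.
\<close>

definition closed_loop_matrix :: "network \<Rightarrow> (nat \<times> nat) set \<Rightarrow> real mat" where
  "closed_loop_matrix G K = block_mat G (\<lambda>i j.
     if i = j then Amat G i
     else if (j, i) \<in> K then Bmat G i j * Cmat G j i
     else 0\<^sub>m (sdim G i) (sdim G j))"

lemma offset_Suc: "offset G (Suc i) = offset G i + sdim G i"
  by (simp add: offset_def)

lemma offset_mono: "i \<le> j \<Longrightarrow> offset G i \<le> offset G j"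
  unfolding offset_def by (rule sum_mono2) auto

lemma block_range_iff:
  assumes "k < sdim G i"
  shows "offset G i + k \<in> block_range G j \<longleftrightarrow> j = i"
proof
  assume *: "offset G i + k \<in> block_range G j"
  show "j = i"
  proof (rule ccontr)
    assume "j \<noteq> i"
    then consider "Suc j \<le> i" | "Suc i \<le> j" by linarith
    then show False
      by cases
        (use offset_mono[of "Suc j" i G] offset_mono[of "Suc i" j G] * assms
          in \<open>auto simp: offset_Suc block_range_def\<close>)
  qed
qed (use assms in \<open>auto simp: block_range_def\<close>)

lemma offset_add_less: "i < N \<Longrightarrow> k < sdim G i \<Longrightarrow> offset G i + k < offset G N"
  using offset_mono[of "Suc i" N G] by (simp add: offset_Suc)

lemma sum_offset:
  fixes f :: "nat \<Rightarrow> real"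
  shows "(\<Sum>p<offset G N. f p) = (\<Sum>i<N. \<Sum>k<sdim G i. f (offset G i + k))"
proof (induction N)
  case 0
  show ?case by (simp add: offset_def)
next
  case (Suc N)
  have "(\<Sum>p<a + b. f p) = (\<Sum>p<a. f p) + (\<Sum>k<b. f (a + k))" for a b
    by (induction b) (simp_all add: algebra_simps)
  then show ?case using Suc by (simp add: offset_Suc)
qed

lemma offset_decompose:
  assumes "p < offset G N"
  obtains i k where "i < N" "k < sdim G i" "p = offset G i + k"
proof -
  have "\<exists>i k. i < N \<and> k < sdim G i \<and> p = offset G i + k" using assms
  proof (induction N)
    case 0
    then show ?case by (simp add: offset_def)
  next
    case (Suc N)
    show ?case
    proof (cases "p < offset G N")
      case True
      then show ?thesis using Suc.IH less_SucI by blast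
    next
      case False
      then show ?thesis using Suc.prems
        by (intro exI[of _ N] exI[of _ "p - offset G N"]) (auto simp: offset_Suc)
    qed
  qed
  then show ?thesis using that by blast
qed

lemma block_col_index:
  assumes "i < nsys G" "k < sdim G i"
  shows "block_col G y $ (offset G i + k) = y i $ k"
  using assms
  by (simp add: block_col_def offset_add_less block_range_iff sum.If_cases if_distrib sum.delta
      cong: if_cong)

lemma block_mat_index:
  assumes "i < nsys G" "k < sdim G i" "j < nsys G" "c < sdim G j"
  shows "block_mat G M $$ (offset G i + k, offset G j + c) = M i j $$ (k, c)"
proof -
  have "(\<Sum>i'<nsys G. \<Sum>j'<nsys G. if i' = i \<and> j' = j
      then M i' j' $$ (offset G i + k - offset G i', offset G j + c - offset G j') else 0)
     = (\<Sum>i'<nsys G. if i' = i then M i j $$ (k, c) else 0)"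
    by (intro sum.cong refl) (use assms in \<open>auto simp: sum.delta\<close>)
  then show ?thesis
    using assms by (simp add: block_mat_def offset_add_less block_range_iff sum.delta)
qed

lemma block_mat_mult_block_col:
  assumes "i < nsys G" "k < sdim G i"
    and M: "\<And>j. j < nsys G \<Longrightarrow> M i j \<in> carrier_mat (sdim G i) (sdim G j)"
    and y: "\<And>j. j < nsys G \<Longrightarrow> y j \<in> carrier_vec (sdim G j)"
  shows "(block_mat G M *\<^sub>v block_col G y) $ (offset G i + k) = (\<Sum>j<nsys G. (M i j *\<^sub>v y j) $ k)"
proof -
  have "(block_mat G M *\<^sub>v block_col G y) $ (offset G i + k)
      = (\<Sum>p<total_dim G. block_mat G M $$ (offset G i + k, p) * block_col G y $ p)"
    using offset_add_less[OF assms(1,2)]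
    by (simp add: block_mat_def block_col_def scalar_prod_def atLeast0LessThan)
  also have "\<dots> = (\<Sum>j<nsys G. \<Sum>c<sdim G j. M i j $$ (k, c) * y j $ c)"
    unfolding sum_offset using assms
    by (intro sum.cong refl) (auto simp: block_mat_index block_col_index)
  also have "\<dots> = (\<Sum>j<nsys G. (M i j *\<^sub>v y j) $ k)"
  proof (intro sum.cong refl)
    fix j assume "j \<in> {..<nsys G}"
    then show "(\<Sum>c<sdim G j. M i j $$ (k, c) * y j $ c) = (M i j *\<^sub>v y j) $ k"
      using M[of j] y[of j] assms(2) by (auto simp: scalar_prod_def atLeast0LessThan)
  qed
  finally show ?thesis .
qed

lemma nbrs_less:
  assumes "dynamical_network G" "j \<in> nbrs G i"
  shows "i < nsys G" "j < nsys G" "j \<noteq> i" "i \<in> nbrs G j"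
  using assms by (auto simp: dynamical_network_def nbrs_def uedges_def)

lemma closed_loop_row:
  assumes G: "dynamical_network G" and K: "K \<subseteq> edges G"
    and i: "i < nsys G" and k: "k < sdim G i"
    and y: "\<And>j. j < nsys G \<Longrightarrow> y j \<in> carrier_vec (sdim G j)"
  shows "(closed_loop_matrix G K *\<^sub>v block_col G y) $ (offset G i + k) =
    (Amat G i *\<^sub>v y i) $ k + (\<Sum>j\<in>nbrs G i.
      (Bmat G i j *\<^sub>v (if (j, i) \<in> K then Cmat G j i *\<^sub>v y j else 0\<^sub>v (idim G i j))) $ k)"
proof -
  let ?M = "\<lambda>i j. if i = j then Amat G i else if (j, i) \<in> K then Bmat G i j * Cmat G j i
     else 0\<^sub>m (sdim G i) (sdim G j)"
  let ?f = "\<lambda>j. (Bmat G i j *\<^sub>v (if (j, i) \<in> K then Cmat G j i *\<^sub>v y j else 0\<^sub>v (idim G i j))) $ k"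
  have A: "Amat G i \<in> carrier_mat (sdim G i) (sdim G i)"
    using G i by (auto simp: dynamical_network_def)
  have BC: "Bmat G i j \<in> carrier_mat (sdim G i) (idim G i j)"
    "Cmat G j i \<in> carrier_mat (idim G i j) (sdim G j)" if "j \<in> nbrs G i" for j
    using G nbrs_less[OF G that] that by (auto simp: dynamical_network_def)
  have Kn: "(j, i) \<in> K \<Longrightarrow> j \<in> nbrs G i" for j
    using K by (auto simp: nbrs_def uedges_def)
  have M: "?M i j \<in> carrier_mat (sdim G i) (sdim G j)" for j
    using A BC[of j] Kn[of j] by auto
  have "(closed_loop_matrix G K *\<^sub>v block_col G y) $ (offset G i + k)
      = (\<Sum>j<nsys G. (?M i j *\<^sub>v y j) $ k)"
    unfolding closed_loop_matrix_def by (rule block_mat_mult_block_col) (use i k M y in auto)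
  also have "\<dots> = (\<Sum>j<nsys G. (if j = i then (Amat G i *\<^sub>v y i) $ k else 0) +
      (if j \<in> nbrs G i then ?f j else 0))"
  proof (intro sum.cong refl)
    fix j assume "j \<in> {..<nsys G}"
    then have j: "j < nsys G" by simp
    show "(?M i j *\<^sub>v y j) $ k = (if j = i then (Amat G i *\<^sub>v y i) $ k else 0) +
      (if j \<in> nbrs G i then ?f j else 0)"
    proof (cases "(j, i) \<in> K")
      case True
      then show ?thesis
        using Kn[OF True] nbrs_less[OF G Kn[OF True]] BC[OF Kn[OF True]] y[OF j]
        by (auto simp: assoc_mult_mat_vec[of _ "sdim G i" "idim G i j" _ "sdim G j"])
    next
      case False
      have "Bmat G i j *\<^sub>v 0\<^sub>v (idim G i j) = 0\<^sub>v (sdim G i)" if "j \<in> nbrs G i"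
        using BC[OF that] by (intro eq_vecI) (auto simp: scalar_prod_def)
      moreover have "0\<^sub>m (sdim G i) (sdim G j) *\<^sub>v y j = 0\<^sub>v (sdim G i)"
        using y[OF j] by (intro eq_vecI) (auto simp: scalar_prod_def)
      ultimately show ?thesis
        using False k nbrs_less(3)[OF G, of j i] by auto
    qed
  qed
  also have "\<dots> = (Amat G i *\<^sub>v y i) $ k + (\<Sum>j\<in>nbrs G i. ?f j)"
  proof -
    have "{..<nsys G} \<inter> nbrs G i = nbrs G i" using nbrs_less(2)[OF G] by auto
    then have "(\<Sum>j<nsys G. if j \<in> nbrs G i then ?f j else 0) = (\<Sum>j\<in>nbrs G i. ?f j)"
      by (subst sum.inter_restrict[symmetric]) simp_all
    then show ?thesis using i by (simp add: sum.distrib)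
  qed
  finally show ?thesis .
qed

text \<open>
  Eliminating the interconnection signals turns the network equations into
  \<open>x' = closed_loop_matrix G K *\<^sub>v x\<close> for the stacked state \<open>x\<close>.
\<close>

lemma network_solution_iff:
  assumes G: "dynamical_network G" and K: "K \<subseteq> edges G"
    and x: "\<And>i t. i < nsys G \<Longrightarrow> t \<ge> 0 \<Longrightarrow> x i t \<in> carrier_vec (sdim G i)"
  shows "(\<exists>v w. network_solution G K x v w) \<longleftrightarrow>
    (\<forall>t\<ge>0. \<forall>p<total_dim G. ((\<lambda>s. block_col G (\<lambda>i. x i s) $ p) has_real_derivative
       (closed_loop_matrix G K *\<^sub>v block_col G (\<lambda>i. x i t)) $ p) (at t within {0..}))"
    (is "?L \<longleftrightarrow> ?R")
proof
  assume ?L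
  then obtain v w where sol: "network_solution G K x v w" by blast
  show ?R
  proof (intro allI impI)
    fix t :: real and p assume t: "t \<ge> 0" and "p < total_dim G"
    then obtain i k where p: "i < nsys G" "k < sdim G i" "p = offset G i + k"
      using offset_decompose by blast
    have "v i j t = (if (j, i) \<in> K then Cmat G j i *\<^sub>v x j t else 0\<^sub>v (idim G i j))"
      if "j \<in> nbrs G i" for j
      using sol t p(1) that nbrs_less[OF G that] by (auto simp: network_solution_def)
    moreover have "((\<lambda>s. x i s $ k) has_real_derivative
        (Amat G i *\<^sub>v x i t) $ k + (\<Sum>j\<in>nbrs G i. (Bmat G i j *\<^sub>v v i j t) $ k)) (at t within {0..})"
      using sol t p unfolding network_solution_def by blast
    ultimately show "((\<lambda>s. block_col G (\<lambda>i. x i s) $ p) has_real_derivative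
       (closed_loop_matrix G K *\<^sub>v block_col G (\<lambda>i. x i t)) $ p) (at t within {0..})"
      using p x t by (simp add: closed_loop_row[OF G K] block_col_index)
  qed
next
  assume R: ?R
  define w where "w = (\<lambda>i j t. Cmat G i j *\<^sub>v x i t)"
  define v where "v = (\<lambda>i j t. if (j, i) \<in> K then w j i t else 0\<^sub>v (idim G i j))"
  have "network_solution G K x v w"
    unfolding network_solution_def
  proof (intro allI impI conjI ballI)
    fix t :: real and i assume t: "t \<ge> 0" and i: "i < nsys G"
    show "x i t \<in> carrier_vec (sdim G i)" using x t i by blast
    {
      fix j assume j: "j \<in> nbrs G i"
      have C: "Cmat G i j \<in> carrier_mat (idim G j i) (sdim G i)"
        "Cmat G j i \<in> carrier_mat (idim G i j) (sdim G j)"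
        using G j nbrs_less[OF G j] by (auto simp: dynamical_network_def)
      have w: "w i j t \<in> carrier_vec (idim G j i)" "w j i t \<in> carrier_vec (idim G i j)"
        unfolding w_def by (rule carrier_vecI, use C in simp)+
      show "w i j t \<in> carrier_vec (idim G j i)" by (rule w)
      show "v i j t \<in> carrier_vec (idim G i j)" using w by (simp add: v_def)
      show "w i j t = Cmat G i j *\<^sub>v x i t" by (simp add: w_def)
      show "v i j t = (if (j, i) \<in> K then w j i t else 0\<^sub>v (idim G i j))" by (simp add: v_def)
    }
    fix k assume k: "k < sdim G i"
    have row: "(closed_loop_matrix G K *\<^sub>v block_col G (\<lambda>i. x i t)) $ (offset G i + k) =
        (Amat G i *\<^sub>v x i t) $ k + (\<Sum>j\<in>nbrs G i. (Bmat G i j *\<^sub>v v i j t) $ k)"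
      unfolding v_def w_def by (rule closed_loop_row[OF G K i k]) (use x t in blast)
    have "((\<lambda>s. block_col G (\<lambda>i. x i s) $ (offset G i + k)) has_real_derivative
       (closed_loop_matrix G K *\<^sub>v block_col G (\<lambda>i. x i t)) $ (offset G i + k)) (at t within {0..})"
      using R t offset_add_less[OF i k] by blast
    then show "((\<lambda>s. x i s $ k) has_real_derivative
        (Amat G i *\<^sub>v x i t) $ k + (\<Sum>j\<in>nbrs G i. (Bmat G i j *\<^sub>v v i j t) $ k)) (at t within {0..})"
      unfolding row block_col_index[OF i k] .
  qed
  then show ?L by blast
qed


section \<open>Additive quadratic Lyapunov functions\<close>

definition pos_def_mat :: "real mat \<Rightarrow> bool" where
  "pos_def_mat M \<longleftrightarrow> square_mat M \<and> M\<^sup>T = M \<and>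
     (\<forall>y\<in>carrier_vec (dim_row M). y \<noteq> 0\<^sub>v (dim_row M) \<longrightarrow> y \<bullet> (M *\<^sub>v y) > 0)"

definition neg_def_mat :: "real mat \<Rightarrow> bool" where
  "neg_def_mat M \<longleftrightarrow> pos_def_mat (- M)"

definition additive_lyapunov :: "network \<Rightarrow> (nat \<Rightarrow> real mat) \<Rightarrow> bool" where
  "additive_lyapunov G P \<longleftrightarrow>
     (\<forall>i<nsys G. P i \<in> carrier_mat (sdim G i) (sdim G i) \<and> pos_def_mat (P i)) \<and>
     (let A = closed_loop_matrix G (edges G); D = diag_block_mat (map P [0..<nsys G])
      in neg_def_mat (A\<^sup>T * D + D * A))"

end

theory Submission
  imports "HOL-Library.Transitive_Closure_Table" "HOL-Analysis.Function_Topology" Defs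
begin

text \<open>
  Deleting the edge \<open>{i, j}\<close> from the forest separates \<open>i\<close> from \<open>j\<close>. Let \<open>S\<close> be the component of
  \<open>i\<close> and let \<open>\<Sigma>\<close> be the diagonal matrix with entry \<open>1\<close> on the states of systems in \<open>S\<close> and \<open>-1\<close> on
  the others. Conjugation by \<open>\<Sigma>\<close> only changes the sign of the blocks of the closed-loop matrix \<open>A\<close> that
  belong to the deleted edge, so the closed-loop matrix of the disconnected network is
  \<open>(A + \<Sigma> A \<Sigma>) / 2\<close>. As \<open>\<Sigma>\<close> commutes with the block-diagonal \<open>P\<close>, the set of matrices for which
  \<open>P\<close> is a Lyapunov matrix is invariant under this conjugation, and it is convex. Hence the original
  Lyapunov function also serves the disconnected network.
\<close>

section \<open>Quadratic forms\<close>

text \<open>Vectors and matrices are functions of which only the values below \<open>n\<close>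
  count. Vectors of type \<open>nat \<Rightarrow> real\<close> thus live in a product space, whose
  topology supplies compactness.\<close>

definition quad_form :: "nat \<Rightarrow> (nat \<Rightarrow> nat \<Rightarrow> real) \<Rightarrow> (nat \<Rightarrow> real) \<Rightarrow> real" where
  "quad_form n M y = (\<Sum>p<n. \<Sum>q<n. M p q * y p * y q)"

text \<open>Symmetry of \<open>M\<close> is not demanded, so the notion applies directly to the
  product \<open>- D A\<close>, which is in general not symmetric.\<close>

definition pos_def_form :: "nat \<Rightarrow> (nat \<Rightarrow> nat \<Rightarrow> real) \<Rightarrow> bool" where
  "pos_def_form n M \<longleftrightarrow> (\<forall>y. (\<exists>p<n. y p \<noteq> 0) \<longrightarrow> 0 < quad_form n M y)"

lemma quad_form_scale: "quad_form n M (\<lambda>p. a * y p) = a\<^sup>2 * quad_form n M y"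
  by (simp add: quad_form_def sum_distrib_left power2_eq_square mult_ac)

lemma quad_form_cong:
  "(\<And>p. p < n \<Longrightarrow> y p = z p) \<Longrightarrow> quad_form n M y = quad_form n M z"
  by (simp add: quad_form_def)

lemma pos_def_form_cong:
  assumes "\<And>p q. p < n \<Longrightarrow> q < n \<Longrightarrow> M p q = M' p q"
  shows "pos_def_form n M \<longleftrightarrow> pos_def_form n M'"
  using assms by (simp add: pos_def_form_def quad_form_def)

text \<open>By Tychonoff, the product of the intervals [-1, 1] below \<open>n\<close> and the
  singletons {0} from \<open>n\<close> on is compact; the sphere is a closed subset of it, since
  every coordinate of a unit vector has modulus at most 1.\<close>

lemma compact_unit_sphere_fun:
  "compact {y :: nat \<Rightarrow> real. (\<forall>p\<ge>n. y p = 0) \<and> (\<Sum>p<n. (y p)\<^sup>2) = 1}"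
proof -
  define B where "B = PiE UNIV (\<lambda>p. if p < n then {-1..1::real} else {0})"
  have "compactin (product_topology (\<lambda>_. euclidean) UNIV) B"
    unfolding B_def by (subst compactin_PiE) auto
  then have "compact B"
    by (simp add: euclidean_product_topology)
  moreover have "closed {y :: nat \<Rightarrow> real. (\<Sum>p<n. (y p)\<^sup>2) = 1}"
    by (intro closed_Collect_eq continuous_intros continuous_on_product_coordinates)
  ultimately have "compact (B \<inter> {y. (\<Sum>p<n. (y p)\<^sup>2) = 1})"
    by blast
  moreover have "B \<inter> {y. (\<Sum>p<n. (y p)\<^sup>2) = 1}
      = {y. (\<forall>p\<ge>n. y p = 0) \<and> (\<Sum>p<n. (y p)\<^sup>2) = 1}"
  proof -
    have "\<bar>y p\<bar> \<le> 1" if "(\<Sum>p<n. (y p)\<^sup>2) = 1" "p < n" for y :: "nat \<Rightarrow> real" and p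
    proof -
      have "(y p)\<^sup>2 \<le> (\<Sum>p<n. (y p)\<^sup>2)"
        by (rule member_le_sum) (use that in auto)
      then show ?thesis using that by (simp add: abs_square_le_1)
    qed
    moreover have "y \<in> B \<longleftrightarrow> (\<forall>p\<ge>n. y p = 0) \<and> (\<forall>p<n. \<bar>y p\<bar> \<le> 1)" for y
      unfolding B_def PiE_UNIV_domain Pi_iff
      by (metis UNIV_I abs_le_iff atLeastAtMost_iff linorder_not_le minus_le_iff singletonD singletonI)
    ultimately show ?thesis by blast
  qed
  ultimately show ?thesis by simp
qed

text \<open>The continuous form attains its minimum on the compact unit sphere, this minimum is
  positive, and homogeneity of degree 2 extends the bound to all vectors.\<close>

lemma pos_def_form_lower_bound:
  assumes M: "pos_def_form n M"
  obtains c where "c > 0" "\<And>y. c * (\<Sum>p<n. (y p)\<^sup>2) \<le> quad_form n M y"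
proof (cases "n = 0")
  case True
  then show ?thesis using that[of 1] by (simp add: quad_form_def)
next
  case False
  define U where "U = {y :: nat \<Rightarrow> real. (\<forall>p\<ge>n. y p = 0) \<and> (\<Sum>p<n. (y p)\<^sup>2) = 1}"
  \<comment> \<open>The first unit vector shows that the sphere is nonempty, which is where
    \<open>n\<close> must be positive.\<close>
  have "(\<lambda>p. if p = 0 then 1 else 0) \<in> U"
    using False by (auto simp: U_def if_distrib[of "\<lambda>x. x\<^sup>2"] cong: if_cong)
  moreover have "continuous_on U (quad_form n M)"
    unfolding quad_form_def
    by (intro continuous_intros continuous_on_subset[OF continuous_on_product_coordinates]) auto
  moreover have "compact U"
    unfolding U_def by (rule compact_unit_sphere_fun)
  ultimately obtain u where u: "u \<in> U" "\<And>y. y \<in> U \<Longrightarrow> quad_form n M u \<le> quad_form n M y"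
    using continuous_attains_inf[of U "quad_form n M"] by blast
  have "\<exists>p<n. u p \<noteq> 0"
  proof (rule ccontr)
    assume "\<not> ?thesis"
    then have "(\<Sum>p<n. (u p)\<^sup>2) = 0" by simp
    then show False using u(1) by (simp add: U_def)
  qed
  then have pos: "quad_form n M u > 0"
    using M by (simp add: pos_def_form_def)
  show ?thesis
  proof (rule that[OF pos])
    fix y :: "nat \<Rightarrow> real"
    define s where "s = (\<Sum>p<n. (y p)\<^sup>2)"
    have s: "s \<ge> 0" by (simp add: s_def sum_nonneg)
    show "quad_form n M u * (\<Sum>p<n. (y p)\<^sup>2) \<le> quad_form n M y"
    proof (cases "s = 0")
      case True
      then have "y p = 0" if "p < n" for p
        using that by (simp add: s_def sum_nonneg_eq_0_iff)
      then show ?thesis using True by (simp add: s_def quad_form_def)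
    next
      case False
      \<comment> \<open>The normalised vector is cut off at \<open>n\<close> to lie in
        \<open>U\<close>; the form does not see the cut-off values.\<close>
      define z where "z = (\<lambda>p. if p < n then (1 / sqrt s) * y p else 0)"
      have "(\<Sum>p<n. (z p)\<^sup>2) = (\<Sum>p<n. (y p)\<^sup>2 / s)"
        using s by (intro sum.cong) (auto simp: z_def power_divide)
      also have "\<dots> = 1"
        using False by (simp add: s_def flip: sum_divide_distrib)
      finally have "z \<in> U" by (simp add: U_def z_def)
      then have "quad_form n M u \<le> quad_form n M z" by (rule u(2))
      also have "quad_form n M z = quad_form n M (\<lambda>p. (1 / sqrt s) * y p)"
        by (rule quad_form_cong) (simp add: z_def)
      also have "\<dots> = quad_form n M y / s"
        unfolding quad_form_scale using s by (simp add: power_divide)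
      finally show ?thesis
        using False s by (simp add: pos_le_divide_eq flip: s_def)
    qed
  qed
qed

text \<open>Each product of two coordinates is at most the squared norm in modulus, by the
  inequality between geometric and arithmetic mean.\<close>

lemma quad_form_upper_bound:
  "quad_form n M y \<le> (\<Sum>p<n. \<Sum>q<n. \<bar>M p q\<bar>) * (\<Sum>p<n. (y p)\<^sup>2)"
  unfolding quad_form_def sum_distrib_right
proof (intro sum_mono)
  fix p q assume pq: "p \<in> {..<n}" "q \<in> {..<n}"
  let ?s = "\<Sum>p<n. (y p)\<^sup>2"
  have "(y p)\<^sup>2 \<le> ?s" "(y q)\<^sup>2 \<le> ?s"
    by (rule member_le_sum; use pq in auto)+
  moreover have "2 * \<bar>y p * y q\<bar> \<le> (y p)\<^sup>2 + (y q)\<^sup>2"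
    using sum_squares_bound[of "\<bar>y p\<bar>" "\<bar>y q\<bar>"] by (simp add: abs_mult)
  ultimately have "\<bar>y p * y q\<bar> \<le> ?s" by linarith
  then have "\<bar>M p q\<bar> * \<bar>y p * y q\<bar> \<le> \<bar>M p q\<bar> * ?s"
    by (rule mult_left_mono) simp
  moreover have "M p q * y p * y q \<le> \<bar>M p q\<bar> * \<bar>y p * y q\<bar>"
    by (metis abs_ge_self abs_mult mult.assoc)
  ultimately show "M p q * y p * y q \<le> \<bar>M p q\<bar> * ?s" by linarith
qed


section \<open>Lyapunov's direct method\<close>

text \<open>The product rule gives two terms, one for each occurrence of \<open>z\<close>; by
  symmetry of \<open>D\<close> they agree, so the derivative of z^T D z is 2 z^T D A z.\<close>

lemma quad_form_has_derivative:
  assumes sym: "\<And>p q. p < n \<Longrightarrow> q < n \<Longrightarrow> D p q = D q p"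
    and z: "\<And>p. p < n \<Longrightarrow> (z p has_real_derivative (\<Sum>q<n. A p q * z q t)) (at t within T)"
  shows "((\<lambda>s. quad_form n D (\<lambda>p. z p s)) has_real_derivative
    2 * quad_form n (\<lambda>p q. \<Sum>r<n. D p r * A r q) (\<lambda>p. z p t)) (at t within T)"
proof -
  let ?z' = "\<lambda>p. \<Sum>q<n. A p q * z q t"
  have 1: "(\<Sum>p<n. \<Sum>q<n. D p q * z p t * ?z' q)
      = quad_form n (\<lambda>p q. \<Sum>r<n. D p r * A r q) (\<lambda>p. z p t)"
    unfolding quad_form_def
  proof (rule sum.cong[OF refl])
    fix p
    have "(\<Sum>q<n. D p q * z p t * ?z' q) = (\<Sum>q<n. \<Sum>r<n. D p q * A q r * z p t * z r t)"
      by (simp add: sum_distrib_left mult_ac)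
    also have "\<dots> = (\<Sum>r<n. \<Sum>q<n. D p q * A q r * z p t * z r t)"
      by (rule sum.swap)
    finally show "(\<Sum>q<n. D p q * z p t * ?z' q) = (\<Sum>q<n. (\<Sum>r<n. D p r * A r q) * z p t * z q t)"
      by (simp add: sum_distrib_right)
  qed
  have "(\<Sum>p<n. \<Sum>q<n. D p q * ?z' p * z q t) = (\<Sum>q<n. \<Sum>p<n. D p q * ?z' p * z q t)"
    by (rule sum.swap)
  also have "\<dots> = (\<Sum>p<n. \<Sum>q<n. D p q * z p t * ?z' q)"
    by (intro sum.cong refl) (simp add: sym)
  finally have 2: "(\<Sum>p<n. \<Sum>q<n. D p q * ?z' p * z q t) = (\<Sum>p<n. \<Sum>q<n. D p q * z p t * ?z' q)" .
  have "((\<lambda>s. quad_form n D (\<lambda>p. z p s)) has_real_derivative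
      (\<Sum>p<n. \<Sum>q<n. D p q * ?z' p * z q t + D p q * z p t * ?z' q)) (at t within T)"
    unfolding quad_form_def
    by (intro DERIV_sum) (auto intro!: derivative_eq_intros z)
  then show ?thesis by (simp add: sum.distrib 1 2)
qed

text \<open>With V(z) = z^T D z, the bounds a |z|^2 \<le> V \<le> b |z|^2 and V' \<le> -2c |z|^2
  give V' \<le> -(2c/b) V. The constants are chosen before the solution \<open>z\<close>, and this
  uniformity is what Lyapunov stability requires.\<close>

lemma lyapunov_exponential_decay:
  assumes sym: "\<And>p q. p < n \<Longrightarrow> q < n \<Longrightarrow> D p q = D q p"
    and D: "pos_def_form n D"
    and DA: "pos_def_form n (\<lambda>p q. - (\<Sum>r<n. D p r * A r q))"
  shows "\<exists>C>0. \<exists>k>0. \<forall>z.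
    (\<forall>t\<ge>0. \<forall>p<n. (z p has_real_derivative (\<Sum>q<n. A p q * z q t)) (at t within {0..})) \<longrightarrow>
    (\<forall>t\<ge>0. (\<Sum>p<n. (z p t)\<^sup>2) \<le> C * (\<Sum>p<n. (z p 0)\<^sup>2) * exp (- k * t))"
proof -
  obtain a where a: "a > 0" "\<And>y. a * (\<Sum>p<n. (y p)\<^sup>2) \<le> quad_form n D y"
    using pos_def_form_lower_bound[OF D] by blast
  let ?DA = "\<lambda>p q. \<Sum>r<n. D p r * A r q"
  obtain c where c: "c > 0" "\<And>y. c * (\<Sum>p<n. (y p)\<^sup>2) \<le> - quad_form n ?DA y"
    using pos_def_form_lower_bound[OF DA] by (auto simp: quad_form_def sum_negf)
  \<comment> \<open>The added 1 keeps \<open>b\<close> positive even when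
    \<open>n = 0\<close>.\<close>
  define b where "b = (\<Sum>p<n. \<Sum>q<n. \<bar>D p q\<bar>) + 1"
  have "b > 0" by (simp add: b_def add_nonneg_pos sum_nonneg)
  have b: "quad_form n D y \<le> b * (\<Sum>p<n. (y p)\<^sup>2)" for y
    using quad_form_upper_bound[of n D y] sum_nonneg[of "{..<n}" "\<lambda>p. (y p)\<^sup>2"]
    by (simp add: b_def algebra_simps)
  define k where "k = 2 * c / b"
  have k: "k > 0" using \<open>b > 0\<close> c(1) by (simp add: k_def)
  have decay: "(\<Sum>p<n. (z p t)\<^sup>2) \<le> b / a * (\<Sum>p<n. (z p 0)\<^sup>2) * exp (- k * t)"
    if z: "\<And>t p. t \<ge> 0 \<Longrightarrow> p < n \<Longrightarrow>
      (z p has_real_derivative (\<Sum>q<n. A p q * z q t)) (at t within {0..})" and t: "t \<ge> 0" for z t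
  proof -
    define V where "V = (\<lambda>t. quad_form n D (\<lambda>p. z p t))"
    \<comment> \<open>The integrating factor turns the differential inequality V' \<le> -k V into
      monotonicity of \<open>W\<close>.\<close>
    define W where "W = (\<lambda>t. V t * exp (k * t))"
    have W': "(W has_real_derivative
        (2 * quad_form n ?DA (\<lambda>p. z p s) + k * V s) * exp (k * s)) (at s within {0..})"
      if "s \<ge> 0" for s
      unfolding W_def V_def
      by (rule derivative_eq_intros quad_form_has_derivative[OF sym z] that refl | assumption)+
        (simp add: algebra_simps)
    have le: "2 * quad_form n ?DA (\<lambda>p. z p s) + k * V s \<le> 0" for s
    proof -
      have "k * V s \<le> k * (b * (\<Sum>p<n. (z p s)\<^sup>2))"
        unfolding V_def by (intro mult_left_mono b) (use k in simp)
      also have "\<dots> = 2 * (c * (\<Sum>p<n. (z p s)\<^sup>2))"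
        using \<open>b > 0\<close> by (simp add: k_def)
      finally show ?thesis using c(2)[of "\<lambda>p. z p s"] by linarith
    qed
    have "W t \<le> W 0"
    proof (rule DERIV_nonpos_imp_decreasing_open[OF t])
      fix s :: real assume s: "0 < s"
      \<comment> \<open>The equations give only a one-sided derivative at 0. The monotonicity rule
        asks for two-sided derivatives in the open interval only, and for continuity up to its
        ends.\<close>
      have "at s within {0..} = at s"
        by (rule at_within_open_subset[of _ "{0<..}"]) (use s in auto)
      then have "DERIV W s :> (2 * quad_form n ?DA (\<lambda>p. z p s) + k * V s) * exp (k * s)"
        using W'[of s] s by simp
      moreover have "(2 * quad_form n ?DA (\<lambda>p. z p s) + k * V s) * exp (k * s) \<le> 0"
        by (rule mult_nonpos_nonneg[OF le]) simp
      ultimately show "\<exists>y. DERIV W s :> y \<and> y \<le> 0" by blast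
    next
      have "continuous_on {0..} W"
        unfolding continuous_on_eq_continuous_within
        by (intro ballI DERIV_continuous[OF W']) simp
      then show "continuous_on {0..t} W"
        by (rule continuous_on_subset) auto
    qed
    then have "V t \<le> V 0 * exp (- k * t)"
      by (simp add: W_def exp_minus field_simps)
    also have "\<dots> \<le> b * (\<Sum>p<n. (z p 0)\<^sup>2) * exp (- k * t)"
      unfolding V_def by (intro mult_right_mono b) simp
    finally have "a * (\<Sum>p<n. (z p t)\<^sup>2) \<le> b * (\<Sum>p<n. (z p 0)\<^sup>2) * exp (- k * t)"
      using a(2)[of "\<lambda>p. z p t"] by (simp add: V_def)
    then show ?thesis using a(1) by (simp add: field_simps)
  qed
  show ?thesis
    by (intro exI[of _ "b / a"] exI[of _ k] conjI allI impI decay) (use a(1) \<open>b > 0\<close> k in auto)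
qed

section \<open>From exponential decay to stability of the network\<close>

lemma network_stable_lyapunov:
  assumes G: "dynamical_network G" and K: "K \<subseteq> edges G"
    and sym: "\<And>p q. p < total_dim G \<Longrightarrow> q < total_dim G \<Longrightarrow> D p q = D q p"
    and D: "pos_def_form (total_dim G) D"
    and DA: "pos_def_form (total_dim G)
      (\<lambda>p q. - (\<Sum>r<total_dim G. D p r * closed_loop_matrix G K $$ (r, q)))"
  shows "network_stable G K"
proof -
  let ?n = "total_dim G"
  obtain C k where C: "C > 0" and k: "k > 0" and decay:
    "\<forall>z. (\<forall>t\<ge>0. \<forall>p<?n. (z p has_real_derivative
        (\<Sum>q<?n. closed_loop_matrix G K $$ (p, q) * z q t)) (at t within {0..})) \<longrightarrow>
      (\<forall>t\<ge>0. (\<Sum>p<?n. (z p t)\<^sup>2) \<le> C * (\<Sum>p<?n. (z p 0)\<^sup>2) * exp (- k * t))"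
    using lyapunov_exponential_decay[where A = "\<lambda>p q. closed_loop_matrix G K $$ (p, q)", OF sym D DA]
    by blast
  have bound: "network_state_norm G x t \<le> sqrt C * network_state_norm G x 0 * exp (- k / 2 * t)"
    if sol: "network_solution G K x v w" and t: "t \<ge> 0" for x v w t
  proof -
    define z where "z = (\<lambda>p s. block_col G (\<lambda>i. x i s) $ p)"
    have x: "x i s \<in> carrier_vec (sdim G i)" if "i < nsys G" "s \<ge> 0" for i s
      using sol that unfolding network_solution_def by blast
    have z': "(z p has_real_derivative (\<Sum>q<?n. closed_loop_matrix G K $$ (p, q) * z q s))
        (at s within {0..})" if "s \<ge> 0" "p < ?n" for s p
    proof -
      have "\<exists>v w. network_solution G K x v w" using sol by blast
      from iffD1[OF network_solution_iff[OF G K x] this]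
      have "(z p has_real_derivative
          (closed_loop_matrix G K *\<^sub>v block_col G (\<lambda>i. x i s)) $ p) (at s within {0..})"
        using that unfolding z_def by simp
      then show ?thesis
        using that(2)
        by (simp add: z_def scalar_prod_def atLeast0LessThan closed_loop_matrix_def block_mat_def
            block_col_def)
    qed
    \<comment> \<open>Stacking the states preserves the Euclidean norm, so the decay of the stacked
      vector is that of the network state.\<close>
    have norm: "network_state_norm G x s = sqrt (\<Sum>p<?n. (z p s)\<^sup>2)" if "s \<ge> 0" for s
    proof -
      have "(\<Sum>i<nsys G. x i s \<bullet> x i s) = (\<Sum>i<nsys G. \<Sum>k<sdim G i. (z (offset G i + k) s)\<^sup>2)"
        using carrier_vecD[OF x[OF _ that]] by (intro sum.cong refl)
          (simp add: z_def block_col_index scalar_prod_def atLeast0LessThan power2_eq_square)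
      then show ?thesis by (simp add: network_state_norm_def sum_offset)
    qed
    have "network_state_norm G x t \<le> sqrt (C * (\<Sum>p<?n. (z p 0)\<^sup>2) * exp (- k * t))"
      unfolding norm[OF t] real_sqrt_le_iff using decay z' t by blast
    also have "\<dots> = sqrt C * network_state_norm G x 0 * sqrt (exp (- k * t))"
      by (simp add: norm real_sqrt_mult)
    \<comment> \<open>Decay was obtained for the squared norm; the square root halves the
      rate.\<close>
    also have "sqrt (exp (- k * t)) = exp (- k / 2 * t)"
      by (rule real_sqrt_unique) (simp_all flip: exp_double)
    finally show ?thesis .
  qed
  have nonneg: "network_state_norm G x t \<ge> 0" for x t
    unfolding network_state_norm_def
    by (auto intro!: real_sqrt_ge_zero sum_nonneg simp: scalar_prod_def)
  show ?thesis
    unfolding network_stable_def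
  proof (intro conjI allI impI)
    fix e :: real assume e: "e > 0"
    show "\<exists>d>0. \<forall>x v w. network_solution G K x v w \<and> network_state_norm G x 0 < d \<longrightarrow>
        (\<forall>t\<ge>0. network_state_norm G x t < e)"
    \<comment> \<open>As the exponential factor is at most 1 for t \<ge> 0, the norm grows by a
      factor of at most \<open>sqrt C\<close>, which dictates this radius.\<close>
    proof (intro exI[of _ "e / sqrt C"] conjI allI impI; (elim conjE)?)
      show "e / sqrt C > 0" using e C by simp
      fix x v w and t :: real
      assume sol: "network_solution G K x v w" and d: "network_state_norm G x 0 < e / sqrt C"
        and t: "t \<ge> 0"
      have "network_state_norm G x t \<le> sqrt C * network_state_norm G x 0 * exp (- k / 2 * t)"
        by (rule bound[OF sol t])
      also have "\<dots> \<le> sqrt C * network_state_norm G x 0 * 1"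
        using k t C nonneg by (intro mult_left_mono) auto
      also have "\<dots> < e" using d C by (simp add: field_simps)
      finally show "network_state_norm G x t < e" .
    qed
  next
    fix x v w assume sol: "network_solution G K x v w"
    let ?f = "\<lambda>t. sqrt C * network_state_norm G x 0 * exp (- k / 2 * t)"
    have "filterlim (\<lambda>t. - k / 2 * t) at_bot at_top"
      using k by (intro filterlim_tendsto_neg_mult_at_bot[OF tendsto_const]) (auto simp: filterlim_ident)
    then have "((\<lambda>t. exp (- k / 2 * t)) \<longlongrightarrow> 0) at_top"
      by (rule filterlim_compose[OF exp_at_bot])
    then have "(?f \<longlongrightarrow> 0) at_top"
      by (rule tendsto_mult_right_zero)
    moreover have "\<forall>\<^sub>F t in at_top. network_state_norm G x t \<le> ?f t"
      using eventually_ge_at_top[of 0] by eventually_elim (rule bound[OF sol])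
    ultimately show "(network_state_norm G x \<longlongrightarrow> 0) at_top"
      using tendsto_sandwich[where f = "\<lambda>_. 0" and g = "network_state_norm G x" and h = ?f]
      by (simp add: nonneg)
  qed
qed


section \<open>Splitting a forest at an edge\<close>

text \<open>\<open>S\<close> is the component of \<open>i\<close> once the edge is deleted. If it
  contained \<open>j\<close>, a simple path from \<open>i\<close> to \<open>j\<close> avoiding the
  edge would close up to a cycle through that edge.\<close>

lemma undirected_acyclic_split:
  assumes G: "dynamical_network G" and acyclic: "undirected_acyclic G" and ij: "(i, j) \<in> uedges G"
  obtains S where "i \<in> S" "j \<notin> S"
    "\<And>a b. (a, b) \<in> uedges G - {(i, j), (j, i)} \<Longrightarrow> a \<in> S \<longleftrightarrow> b \<in> S"
proof -
  define R where "R = (\<lambda>a b. (a, b) \<in> uedges G - {(i, j), (j, i)})"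
  have R_sym: "R a b \<Longrightarrow> R b a" for a b by (auto simp: R_def uedges_def)
  have "i \<noteq> j" using nbrs_less(3)[OF G, of j i] ij by (auto simp: nbrs_def)
  have "\<not> R\<^sup>*\<^sup>* i j"
  proof
    assume "R\<^sup>*\<^sup>* i j"
    then obtain xs where "rtrancl_path R i xs j"
      unfolding rtranclp_eq_rtrancl_path by blast
    then obtain xs where xs: "rtrancl_path R i xs j" and dist: "distinct (i # xs)"
      by (rule rtrancl_path_distinct)
    have "xs \<noteq> []" using xs \<open>i \<noteq> j\<close> by (auto elim: rtrancl_path.cases)
    have last: "xs ! (length xs - 1) = j"
      using rtrancl_path_last[OF xs \<open>xs \<noteq> []\<close>] \<open>xs \<noteq> []\<close> by (simp add: last_conv_nth)
    have nth: "R ((i # xs) ! k) (xs ! k)" if "k < length xs" for k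
      using rtrancl_path_nth[OF xs that] .
    \<comment> \<open>A path with a single step would be the deleted edge itself; hence the cycle
      has at least three vertices.\<close>
    have "length xs \<noteq> 1"
      using nth[of 0] last \<open>xs \<noteq> []\<close> by (auto simp: R_def)
    then have len: "length (i # xs) \<ge> 3" using \<open>xs \<noteq> []\<close> by (cases xs; cases "tl xs") auto
    have "((i # xs) ! k, (i # xs) ! (Suc k mod length (i # xs))) \<in> uedges G"
      if k: "k < length (i # xs)" for k
    \<comment> \<open>The wrap-around step from \<open>j\<close> back to \<open>i\<close> is the
      deleted edge; all other steps belong to the path.\<close>
    proof (cases "k = length xs")
      case True
      then have "(i # xs) ! k = j" using last \<open>xs \<noteq> []\<close> by (simp add: nth_Cons')
      then show ?thesis using True ij by (auto simp: uedges_def)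
    next
      case False
      then show ?thesis using k nth[of k] by (simp add: R_def)
    qed
    then show False
      using acyclic len dist unfolding undirected_acyclic_def by blast
  qed
  show ?thesis
  proof (rule that[of "{a. R\<^sup>*\<^sup>* i a}"])
    fix a b assume "(a, b) \<in> uedges G - {(i, j), (j, i)}"
    then have "R a b" "R b a" using R_sym by (auto simp: R_def)
    then show "a \<in> {a. R\<^sup>*\<^sup>* i a} \<longleftrightarrow> b \<in> {a. R\<^sup>*\<^sup>* i a}"
      by (auto intro: rtranclp.rtrancl_into_rtrancl)
  qed (use \<open>\<not> R\<^sup>*\<^sup>* i j\<close> in auto)
qed


section \<open>The disconnected network\<close>

lemma closed_loop_index:
  assumes "i < nsys G" "k < sdim G i" "j < nsys G" "c < sdim G j"
  shows "closed_loop_matrix G K $$ (offset G i + k, offset G j + c) =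
    (if i = j then Amat G i $$ (k, c) else if (j, i) \<in> K then (Bmat G i j * Cmat G j i) $$ (k, c)
     else 0)"
  using assms by (simp add: closed_loop_matrix_def block_mat_index)

lemma diag_block_mat_offset_carrier:
  assumes P: "\<And>l. l < N \<Longrightarrow> P l \<in> carrier_mat (sdim G l) (sdim G l)"
  shows "diag_block_mat (map P [0..<N]) \<in> carrier_mat (offset G N) (offset G N)"
proof -
  have "sum_list (map dim_row (map P [0..<N])) = offset G N"
    "sum_list (map dim_col (map P [0..<N])) = offset G N"
    unfolding offset_def interv_sum_list_conv_sum_set_nat map_map atLeast0LessThan set_upt
    using P by (intro sum.cong; fastforce)+
  then show ?thesis by (auto simp: dim_diag_block_mat)
qed

text \<open>Induction peels off the last block: an index belonging to system \<open>l\<close> falls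
  into the leading part exactly when \<open>l < N\<close>.\<close>

lemma diag_block_mat_index_offset:
  assumes P: "\<And>l. l < N \<Longrightarrow> P l \<in> carrier_mat (sdim G l) (sdim G l)"
    and "i < N" "k < sdim G i" "j < N" "c < sdim G j"
  shows "diag_block_mat (map P [0..<N]) $$ (offset G i + k, offset G j + c) =
    (if i = j then P i $$ (k, c) else 0)"
  using assms
proof (induction N)
  case (Suc N)
  let ?D = "diag_block_mat (map P [0..<N])"
  have dim: "dim_row ?D = offset G N" "dim_col ?D = offset G N"
    using diag_block_mat_offset_carrier[of N P G] Suc.prems(1) by auto
  have dimP: "dim_row (P N) = sdim G N" "dim_col (P N) = sdim G N"
    using Suc.prems(1)[of N] by auto
  have lt: "offset G l + m < offset G N \<longleftrightarrow> l < N" if "l < Suc N" "m < sdim G l" for l m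
    using offset_add_less[of l N m G] that by (cases "l = N") auto
  have lt': "offset G l + m < offset G N + sdim G N" if "l < Suc N" "m < sdim G l" for l m
    using offset_add_less[OF that] by (simp add: offset_Suc)
  have "diag_block_mat (map P [0..<Suc N]) $$ (offset G i + k, offset G j + c) =
    (if i < N then if j < N then ?D $$ (offset G i + k, offset G j + c) else 0
     else if j < N then 0
     else P N $$ (offset G i + k - offset G N, offset G j + c - offset G N))"
  proof -
    have "i < N \<or> i = N" "j < N \<or> j = N" using Suc.prems(2,4) by auto
    then show ?thesis
      using lt[OF Suc.prems(2,3)] lt[OF Suc.prems(4,5)] lt'[OF Suc.prems(2,3)] lt'[OF Suc.prems(4,5)]
        Suc.prems(3,5)
      by (auto simp: diag_block_mat_last Let_def dim dimP)
  qed
  also have "\<dots> = (if i = j then P i $$ (k, c) else 0)"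
    using Suc.IH[OF Suc.prems(1) _ Suc.prems(3) _ Suc.prems(5)] Suc.prems(2,4)
    by (auto simp: less_Suc_eq)
  finally show ?case .
qed simp

text \<open>The deleted edge crosses between \<open>S\<close> and its complement and no remaining
  edge does, so disconnecting it annihilates exactly the crossing blocks.\<close>

lemma closed_loop_disconnect:
  assumes split: "\<And>a b. (a, b) \<in> uedges G - {(i, j), (j, i)} \<Longrightarrow> a \<in> S \<longleftrightarrow> b \<in> S"
    and S: "i \<in> S" "j \<notin> S"
    and p: "a < nsys G" "k < sdim G a" and q: "b < nsys G" "c < sdim G b"
  shows "closed_loop_matrix G (edges G - {(i, j), (j, i)}) $$ (offset G a + k, offset G b + c) =
    (if a \<in> S \<longleftrightarrow> b \<in> S then closed_loop_matrix G (edges G) $$ (offset G a + k, offset G b + c) else 0)"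
  unfolding closed_loop_index[OF p q] using split[of b a] S by (auto simp: uedges_def)

section \<open>Definiteness of matrices as positivity of forms\<close>

lemma pos_def_mat_form:
  assumes M: "M \<in> carrier_mat n n" and pd: "pos_def_mat M"
  shows "pos_def_form n (\<lambda>p q. M $$ (p, q))"
  unfolding pos_def_form_def
proof (intro allI impI)
  fix y :: "nat \<Rightarrow> real" assume "\<exists>p<n. y p \<noteq> 0"
  then have "vec n y \<noteq> 0\<^sub>v n"
    by (metis index_vec index_zero_vec(1))
  then have "vec n y \<bullet> (M *\<^sub>v vec n y) > 0"
    using pd M by (auto simp: pos_def_mat_def)
  also have "vec n y \<bullet> (M *\<^sub>v vec n y) = quad_form n (\<lambda>p q. M $$ (p, q)) y"
    using M by (auto simp: quad_form_def scalar_prod_def atLeast0LessThan sum_distrib_left mult_ac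
        intro!: sum.cong)
  finally show "0 < quad_form n (\<lambda>p q. M $$ (p, q)) y" .
qed

text \<open>The form splits into a sum over the blocks. Every summand is nonnegative, and one that
  meets a nonzero coordinate is positive.\<close>

lemma diag_block_mat_pos_def_form:
  assumes P: "\<And>l. l < N \<Longrightarrow> P l \<in> carrier_mat (sdim G l) (sdim G l)"
    and pd: "\<And>l. l < N \<Longrightarrow> pos_def_mat (P l)"
  shows "pos_def_form (offset G N) (\<lambda>p q. diag_block_mat (map P [0..<N]) $$ (p, q))"
    (is "pos_def_form ?n ?D")
  unfolding pos_def_form_def
proof (intro allI impI)
  fix y :: "nat \<Rightarrow> real" assume "\<exists>p<?n. y p \<noteq> 0"
  then obtain i k where ik: "i < N" "k < sdim G i" "y (offset G i + k) \<noteq> 0"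
    using offset_decompose by metis
  let ?f = "\<lambda>i. quad_form (sdim G i) (\<lambda>k c. P i $$ (k, c)) (\<lambda>k. y (offset G i + k))"
  have "quad_form ?n ?D y = (\<Sum>i<N. \<Sum>k<sdim G i. \<Sum>j<N. if j = i then
      \<Sum>c<sdim G i. P i $$ (k, c) * y (offset G i + k) * y (offset G i + c) else 0)"
    unfolding quad_form_def sum_offset
    by (intro sum.cong refl) (auto simp: diag_block_mat_index_offset[OF P])
  also have "\<dots> = (\<Sum>i<N. ?f i)"
    by (intro sum.cong refl) (simp add: quad_form_def)
  also have "\<dots> > 0"
  proof (rule sum_pos2)
    have form: "pos_def_form (sdim G l) (\<lambda>k c. P l $$ (k, c))" if "l < N" for l
      using pos_def_mat_form[OF P pd] that by blast
    show "0 < ?f i"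
      using form[OF ik(1)] ik(2,3) by (auto simp: pos_def_form_def)
    show "0 \<le> ?f l" if "l \<in> {..<N}" for l
    proof (cases "\<exists>k<sdim G l. y (offset G l + k) \<noteq> 0")
      case True
      then show ?thesis using form[of l] that by (auto simp: pos_def_form_def intro: less_imp_le)
    next
      case False
      then show ?thesis by (simp add: quad_form_def)
    qed
  qed (use ik in auto)
  finally show "0 < quad_form ?n ?D y" .
qed

text \<open>For symmetric \<open>D\<close>, A^T D is the transpose of D A and has the same quadratic
  form, so the Lyapunov expression has twice the form of D A.\<close>

lemma neg_def_mat_form:
  assumes A: "A \<in> carrier_mat n n" and D: "D \<in> carrier_mat n n"
    and sym: "\<And>p q. p < n \<Longrightarrow> q < n \<Longrightarrow> D $$ (p, q) = D $$ (q, p)"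
    and nd: "neg_def_mat (A\<^sup>T * D + D * A)"
  shows "pos_def_form n (\<lambda>p q. - (\<Sum>r<n. D $$ (p, r) * A $$ (r, q)))"
proof -
  let ?M = "\<lambda>p q. \<Sum>r<n. D $$ (p, r) * A $$ (r, q)"
  have "quad_form n (\<lambda>p q. (- (A\<^sup>T * D + D * A)) $$ (p, q)) y = 2 * quad_form n (\<lambda>p q. - ?M p q) y"
    for y
  proof -
    have entry: "(- (A\<^sup>T * D + D * A)) $$ (p, q) = - ?M q p - ?M p q" if "p < n" "q < n" for p q
    proof -
      have "(\<Sum>r<n. A $$ (r, p) * D $$ (r, q)) = ?M q p"
        by (rule sum.cong) (use that in \<open>auto simp: sym[of q]\<close>)
      then show ?thesis
        using A D that by (simp add: scalar_prod_def atLeast0LessThan)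
    qed
    have "quad_form n (\<lambda>p q. (- (A\<^sup>T * D + D * A)) $$ (p, q)) y
        = (\<Sum>p<n. \<Sum>q<n. - ?M q p * y q * y p) + quad_form n (\<lambda>p q. - ?M p q) y"
      unfolding quad_form_def sum.distrib[symmetric]
      by (intro sum.cong refl) (simp add: entry algebra_simps)
    also have "(\<Sum>p<n. \<Sum>q<n. - ?M q p * y q * y p) = quad_form n (\<lambda>p q. - ?M p q) y"
      unfolding quad_form_def by (rule sum.swap)
    finally show ?thesis by simp
  qed
  moreover have "pos_def_form n (\<lambda>p q. (- (A\<^sup>T * D + D * A)) $$ (p, q))"
    using nd A D unfolding neg_def_mat_def by (intro pos_def_mat_form) auto
  ultimately show ?thesis by (simp add: pos_def_form_def)
qed

text \<open>The new form at \<open>y\<close> is the mean of the old form at \<open>y\<close> and at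
  the vector with entries \<open>\<sigma> p * y p\<close>. The latter is nonzero whenever
  \<open>y\<close> is, so both contributions are positive.\<close>

lemma pos_def_form_sign_average:
  assumes M: "pos_def_form n M" and s: "\<And>p. p < n \<Longrightarrow> \<sigma> p \<noteq> 0"
  shows "pos_def_form n (\<lambda>p q. M p q * ((1 + \<sigma> p * \<sigma> q) / 2))"
  unfolding pos_def_form_def
proof (intro allI impI)
  fix y :: "nat \<Rightarrow> real" assume y: "\<exists>p<n. y p \<noteq> 0"
  then have "\<exists>p<n. \<sigma> p * y p \<noteq> 0" using s by auto
  then have "0 < quad_form n M y + quad_form n M (\<lambda>p. \<sigma> p * y p)"
    using M y unfolding pos_def_form_def by (intro add_pos_pos) auto
  also have "\<dots> = 2 * quad_form n (\<lambda>p q. M p q * ((1 + \<sigma> p * \<sigma> q) / 2)) y"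
    unfolding quad_form_def sum_distrib_left sum.distrib[symmetric]
    by (intro sum.cong refl) (simp add: algebra_simps)
  finally show "0 < quad_form n (\<lambda>p q. M p q * ((1 + \<sigma> p * \<sigma> q) / 2)) y" by simp
qed

theorem corollary5p3:
  fixes G :: network and P :: "nat \<Rightarrow> real mat"
  assumes "dynamical_network G"
    and "undirected_acyclic G"
    and "additive_lyapunov G P"
  shows "\<forall>(i, j) \<in> uedges G. network_stable G (edges G - {(i, j), (j, i)})"
proof (intro ballI, clarify)
  fix i j assume ij: "(i, j) \<in> uedges G"
  obtain S where S: "i \<in> S" "j \<notin> S"
    and split: "\<And>a b. (a, b) \<in> uedges G - {(i, j), (j, i)} \<Longrightarrow> a \<in> S \<longleftrightarrow> b \<in> S"
    using undirected_acyclic_split[OF assms(1,2) ij] by metis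
  define n where "n = total_dim G"
  define K where "K = edges G - {(i, j), (j, i)}"
  define D where "D = diag_block_mat (map P [0..<nsys G])"
  let ?A = "closed_loop_matrix G (edges G)"
  have P: "P l \<in> carrier_mat (sdim G l) (sdim G l)" "pos_def_mat (P l)" if "l < nsys G" for l
    using assms(3) that by (auto simp: additive_lyapunov_def)
  have D: "D \<in> carrier_mat n n"
    unfolding D_def n_def by (rule diag_block_mat_offset_carrier) (rule P)
  have A: "?A \<in> carrier_mat n n"
    by (simp add: closed_loop_matrix_def block_mat_def n_def)
  have D_index: "D $$ (offset G a + k, offset G b + c) = (if a = b then P a $$ (k, c) else 0)"
    if "a < nsys G" "k < sdim G a" "b < nsys G" "c < sdim G b" for a k b c
    unfolding D_def by (rule diag_block_mat_index_offset[OF P(1)]) (use that in auto)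
  have sym: "D $$ (p, q) = D $$ (q, p)" if pq: "p < n" "q < n" for p q
  proof -
    obtain a k where a: "a < nsys G" "k < sdim G a" "p = offset G a + k"
      using offset_decompose pq(1) unfolding n_def by blast
    obtain b c where b: "b < nsys G" "c < sdim G b" "q = offset G b + c"
      using offset_decompose pq(2) unfolding n_def by blast
    \<comment> \<open>Symmetry within a block is part of \<open>pos_def_mat\<close>; entries of
      \<open>D\<close> across blocks vanish.\<close>
    have "P a $$ (k, c) = P a $$ (c, k)" if "c < sdim G a"
      using P[OF a(1)] a(2) that by (metis carrier_matD index_transpose_mat(1) pos_def_mat_def)
    then show ?thesis using a b by (auto simp: D_index)
  qed
  have nd: "neg_def_mat (?A\<^sup>T * D + D * ?A)"
    using assms(3) by (simp add: additive_lyapunov_def D_def Let_def)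
  \<comment> \<open>This is the diagonal of \<Sigma>.\<close>
  define \<sigma> :: "nat \<Rightarrow> real" where "\<sigma> = (\<lambda>p. if \<exists>a\<in>S. p \<in> block_range G a then 1 else -1)"
  have \<sigma>: "\<sigma> (offset G a + k) = (if a \<in> S then 1 else -1)" if "k < sdim G a" for a k
    using that by (auto simp: \<sigma>_def block_range_iff)
  \<comment> \<open>The factor is 1 if \<open>p\<close> and \<open>q\<close> lie on the same side of
    \<open>S\<close> and 0 otherwise. Where \<open>D $$ (p, r)\<close> is nonzero, \<open>p\<close>
    and \<open>r\<close> belong to one system, so the side of \<open>r\<close> can be read off from
    \<open>p\<close>. The factor is then free of \<open>r\<close> and can be pulled out of the sum
    over \<open>r\<close>.\<close>
  have sign: "D $$ (p, r) * closed_loop_matrix G K $$ (r, q)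
      = D $$ (p, r) * ?A $$ (r, q) * ((1 + \<sigma> p * \<sigma> q) / 2)" if "p < n" "r < n" "q < n" for p q r
  proof -
    obtain a k where a: "a < nsys G" "k < sdim G a" "p = offset G a + k"
      using offset_decompose \<open>p < n\<close> unfolding n_def by blast
    obtain b c where b: "b < nsys G" "c < sdim G b" "r = offset G b + c"
      using offset_decompose \<open>r < n\<close> unfolding n_def by blast
    obtain d m where d: "d < nsys G" "m < sdim G d" "q = offset G d + m"
      using offset_decompose \<open>q < n\<close> unfolding n_def by blast
    show ?thesis
      using a b d closed_loop_disconnect[OF split S b(1,2) d(1,2)] by (auto simp: D_index \<sigma> K_def)
  qed
  have "(\<Sum>r<n. D $$ (p, r) * closed_loop_matrix G K $$ (r, q))
      = (\<Sum>r<n. D $$ (p, r) * ?A $$ (r, q)) * ((1 + \<sigma> p * \<sigma> q) / 2)" if "p < n" "q < n" for p q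
    unfolding sum_distrib_right by (intro sum.cong refl sign) (use that in auto)
  then have "pos_def_form n (\<lambda>p q. - (\<Sum>r<n. D $$ (p, r) * closed_loop_matrix G K $$ (r, q)))
      \<longleftrightarrow> pos_def_form n (\<lambda>p q. - (\<Sum>r<n. D $$ (p, r) * ?A $$ (r, q)) * ((1 + \<sigma> p * \<sigma> q) / 2))"
    by (intro pos_def_form_cong) simp
  moreover have "\<dots>"
    by (intro pos_def_form_sign_average neg_def_mat_form[OF A D sym nd]) (auto simp: \<sigma>_def)
  ultimately have DA: "pos_def_form n
      (\<lambda>p q. - (\<Sum>r<n. D $$ (p, r) * closed_loop_matrix G K $$ (r, q)))" by blast
  \<comment> \<open>The matrix \<open>D\<close> of the original network is a Lyapunov matrix for the
    disconnected one too.\<close>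
  show "network_stable G K"
    using network_stable_lyapunov[OF assms(1) _ sym[unfolded n_def] _ DA[unfolded n_def]]
      diag_block_mat_pos_def_form[OF P, where N = "nsys G"]
    by (auto simp: D_def K_def)
qed

end
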